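(* Let $t$ be an odd positive integer, let $G = \mathbb{Z}_t \times (\mathbb{Z}_2)^2$, and let $(A,B)$ be an $(r,s)$-near-factorization of $G$ such that $A$ and $B$ are both symmetric, where $r \equiv 1 \pmod 4$ and $s \equiv 3 \pmod 4$. For $i,j \in \{0,1\}$ let $G_{i,j} = \mathbb{Z}_t \times \{i\} \times \{j\}$, $A_{i,j} = A \cap G_{i,j}$, $B_{i,j} = B \cap G_{i,j}$, $a_{i,j} = |A_{i,j}|$ and $b_{i,j} = |B_{i,j}|$. Then: 1. Three of $a_{0,0}, a_{0,1}, a_{1,0}, a_{1,1}$ equal $(r-1)/4$ and the other equals $(r+3)/4$; three of $b_{0,0}, b_{0,1}, b_{1,0}, b_{1,1}$ equal $(s+1)/4$ and the other equals $(s-3)/4$; and $a_{i,j} = (r+3)/4$ and $b_{i,j} = (s-3)/4$ occur for the same indices $(i,j)$. 2. For each ordered pair $(i,j) \in \{0,1\}^2$, exactly one of $a_{i,j}$ and $b_{i,j}$ is even. 3. The odd values among the $a_{i,j}$'s and $b_{i,j}$'s correspond to the sets $A_{i,j}$ and $B_{i,j}$ that contain involutions; that is, $a_{i,j}$ is odd if and only if $A_{i,j}$ contains an involution, and $b_{i,j}$ is odd if and only if $B_{i,j}$ contains an involution.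
   Context: Let $G$ be a finite additive abelian group with identity $0$. For $A, B \subseteq G$, let $A+B = \{g+h : g \in A, h \in B\}$. The pair $(A,B)$ is an $(r,s)$-near-factorization of $G$ if $|A| = r$, $|B| = s$, $rs = |G| - 1$ and $A + B = G \setminus \{0\}$. A subset $A \subseteq G$ is symmetric if, for all $g \in G$, $g \in A$ if and only if $-g \in A$. An involution of $G$ is any element $x$ with $x = -x$ (so $0$ is counted as an involution). For $t$ odd, the involutions of $\mathbb{Z}_t \times (\mathbb{Z}_2)^2$ are the four elements $(0,i,j)$ with $i,j \in \{0,1\}$, one in each $\mathbb{Z}_t \times \{i\} \times \{j\}$. Since $rs = 4t-1$, one of $r$ and $s$ is congruent to $1$ modulo $4$ and the other to $3$ modulo $4$, so the congruence conditions on $r$ and $s$ can be achieved by interchanging $A$ and $B$ if necessary. *)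

theory Defs
  imports Complex_Main "HOL-Algebra.Elementary_Groups" "HOL-Algebra.Coset"
begin

text \<open>HOL-Algebra writes groups multiplicatively: the sum set \<open>A + B\<close> is \<open>A <#>\<^bsub>G\<^esub> B\<close>,
  \<open>- g\<close> is \<open>inv\<^bsub>G\<^esub> g\<close>, and the identity \<open>0\<close> is \<open>\<one>\<^bsub>G\<^esub>\<close>.  The definitions below are meant
  for finite abelian groups.\<close>

definition near_factorization ::
    "('a, 'b) monoid_scheme \<Rightarrow> nat \<Rightarrow> nat \<Rightarrow> 'a set \<Rightarrow> 'a set \<Rightarrow> bool" where
  "near_factorization G r s A B \<longleftrightarrow>
     A \<subseteq> carrier G \<and> B \<subseteq> carrier G \<and> card A = r \<and> card B = s \<and>
     r * s = order G - 1 \<and> A <#>\<^bsub>G\<^esub> B = carrier G - {\<one>\<^bsub>G\<^esub>}"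

definition symmetric_subset :: "('a, 'b) monoid_scheme \<Rightarrow> 'a set \<Rightarrow> bool" where
  "symmetric_subset G A \<longleftrightarrow> A \<subseteq> carrier G \<and> (\<forall>g\<in>carrier G. g \<in> A \<longleftrightarrow> inv\<^bsub>G\<^esub> g \<in> A)"

text \<open>The identity element counts as an involution.\<close>

definition involution :: "('a, 'b) monoid_scheme \<Rightarrow> 'a \<Rightarrow> bool" where
  "involution G x \<longleftrightarrow> x \<in> carrier G \<and> x = inv\<^bsub>G\<^esub> x"

text \<open>The group \<open>\<int>\<^sub>t \<times> \<int>\<^sub>2 \<times> \<int>\<^sub>2\<close>; for \<open>n > 0\<close>, \<open>\<int>\<^sub>n\<close> has carrier \<open>{0..<int n}\<close>.\<close>

definition Zt22 :: "nat \<Rightarrow> (int \<times> int \<times> int) monoid" where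
  "Zt22 t = integer_mod_group t \<times>\<times> (integer_mod_group 2 \<times>\<times> integer_mod_group 2)"

definition part :: "nat \<Rightarrow> (int \<times> int \<times> int) set \<Rightarrow> int \<Rightarrow> int \<Rightarrow> (int \<times> int \<times> int) set" where
  "part t X i j = X \<inter> (carrier (integer_mod_group t) \<times> {i} \<times> {j})"

end

theory Submission
  imports Defs
begin

text \<open>Project to \<open>\<int>\<^sub>2 \<times> \<int>\<^sub>2\<close>. Every element of \<open>G - {0}\<close> is uniquely a sum \<open>a + b\<close>, so a
  nontrivial character \<open>\<chi>\<close> of \<open>\<int>\<^sub>2 \<times> \<int>\<^sub>2\<close> satisfies \<open>\<chi>(A) \<chi>(B) = \<chi>(G) - 1 = -1\<close>. These values
  are integers, hence \<open>\<chi>(A) = - \<chi>(B) = \<plusminus>1\<close>; inverting the transform and using \<open>r \<equiv> 1\<close>,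
  \<open>s \<equiv> 3 (mod 4)\<close> leaves four possibilities for the part sizes. If \<open>r = 4u + 1\<close> and
  \<open>s = 4v - 1\<close>, then \<open>t = 4uv - u + v\<close> is odd, so \<open>u\<close> and \<open>v\<close> have different parity. Finally,
  negation acts on each part of a symmetric set with only the involution as a fixed point.\<close>

section \<open>Coordinates, inverses and involutions in \<open>Zt22 t\<close>\<close>

lemma carrier_Zt22:
  assumes "t > 0"
  shows "carrier (Zt22 t) = {0..<int t} \<times> {0,1} \<times> {0,1}"
  using assms by (auto simp: Zt22_def carrier_integer_mod_group DirProd_def)

lemma mult_Zt22:
  "(x, i, j) \<otimes>\<^bsub>Zt22 t\<^esub> (y, k, l) = ((x + y) mod int t, (i + k) mod 2, (j + l) mod 2)"
  by (simp add: Zt22_def)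

text \<open>The last two coordinates survive because every element of the integers mod 2 is its own
  inverse; hence negation never leaves a part.\<close>

lemma inv_Zt22:
  assumes "t > 0" "(x, i, j) \<in> carrier (Zt22 t)"
  shows "inv\<^bsub>Zt22 t\<^esub> (x, i, j) = ((- x) mod int t, i, j)"
proof -
  have "x \<in> carrier (integer_mod_group t)" "i \<in> carrier (integer_mod_group 2)"
    "j \<in> carrier (integer_mod_group 2)" "i \<in> {0,1}" "j \<in> {0,1}"
    using assms by (auto simp: Zt22_def carrier_integer_mod_group)
  then show ?thesis
    by (auto simp: Zt22_def inv_DirProd DirProd_group inv_integer_mod_group)
qed

text \<open>Only the first coordinate imposes a condition. A nonzero representative \<open>x\<close>
  fixed by negation would satisfy \<open>x = t - x\<close>, making \<open>t\<close> even.\<close>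

lemma involution_Zt22_iff:
  assumes "odd t" "t > 0"
  shows "involution (Zt22 t) (x, i, j) \<longleftrightarrow> x = 0 \<and> i \<in> {0,1} \<and> j \<in> {0,1}"
proof -
  have "x = 0" if "0 \<le> x" "x < int t" "x = (- x) mod int t"
  proof (rule ccontr)
    assume "x \<noteq> 0"
    then have "(- x) mod int t = int t - x"
      using that by (simp add: zmod_zminus1_eq_if)
    then have "int t = 2 * x" using that by simp
    then show False using assms(1) by presburger
  qed
  then show ?thesis
    using assms inv_Zt22[OF assms(2), of x i j]
    by (auto simp: involution_def carrier_Zt22)
qed

section \<open>Parity of symmetric parts\<close>

lemma even_card_fixpoint_free_involution:
  assumes "finite S" "\<And>x. x \<in> S \<Longrightarrow> f x \<in> S" "\<And>x. x \<in> S \<Longrightarrow> f (f x) = x"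
    "\<And>x. x \<in> S \<Longrightarrow> f x \<noteq> x"
  shows "even (card S)"
  using assms
proof (induction S rule: finite_psubset_induct)
  case (psubset S)
  show ?case
  proof (cases "S = {}")
    case False
    then obtain x where x: "x \<in> S" by blast
    \<comment> \<open>Deleting a whole orbit keeps the set closed: as \<open>f\<close> is
      self-inverse, only \<open>x\<close> and \<open>f x\<close> are mapped into
      \<open>{x, f x}\<close>.\<close>
    have "even (card (S - {x, f x}))"
      by (rule psubset.IH) (use x psubset.prems in \<open>auto, metis+\<close>)
    moreover have "card S = card (S - {x, f x}) + card {x, f x}"
      using x psubset.prems psubset.hyps
      by (metis card_Diff_subset card_mono empty_subsetI finite.emptyI finite.insertI
          insert_subset le_add_diff_inverse2)
    moreover have "card {x, f x} = 2" using psubset.prems(3)[OF x] by auto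
    ultimately show ?thesis by simp
  qed simp
qed

lemma odd_card_part_iff:
  assumes "odd t" "t > 0" "symmetric_subset (Zt22 t) X" "i \<in> {0,1}" "j \<in> {0,1}"
  shows "odd (card (part t X i j)) \<longleftrightarrow> (\<exists>x\<in>part t X i j. involution (Zt22 t) x)"
proof -
  let ?P = "part t X i j" and ?z = "(0 :: int, i, j)"
  let ?f = "\<lambda>x. inv\<^bsub>Zt22 t\<^esub> x"
  have G: "group (Zt22 t)" by (simp add: Zt22_def DirProd_group)
  have PG: "?P \<subseteq> carrier (Zt22 t)"
    using assms(3) by (auto simp: part_def symmetric_subset_def)
  then have fin: "finite ?P"
    by (rule finite_subset) (simp add: carrier_Zt22 assms(2))
  have closed: "?f x \<in> ?P" if xP: "x \<in> ?P" for x
  proof -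
    obtain a where x: "x = (a, i, j)"
      using xP by (cases x) (auto simp: part_def)
    have xG: "x \<in> carrier (Zt22 t)" using PG that by auto
    then have "?f x \<in> X"
      using assms(3) that by (auto simp: part_def symmetric_subset_def)
    then show ?thesis
      using inv_Zt22[OF assms(2)] xG assms(2) by (simp add: x part_def carrier_integer_mod_group)
  qed
  have invol: "?f (?f x) = x" if "x \<in> ?P" for x
    using that PG by (auto intro: group.inv_inv[OF G])
  have fix_iff: "involution (Zt22 t) x \<longleftrightarrow> x = ?z" if "x \<in> ?P" for x
    using that assms(4,5) by (auto simp: part_def involution_Zt22_iff[OF assms(1,2)])
  have free: "?f x \<noteq> x" if "x \<in> ?P" "x \<noteq> ?z" for x
    using fix_iff[OF that(1)] that PG by (auto simp: involution_def)
  \<comment> \<open>Needed for negation to preserve \<open>?P - {?z}\<close>: if \<open>?f x\<close>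
    is the involution \<open>?z\<close>, then it equals its own inverse, which is
    \<open>x\<close>.\<close>
  have fz: "?f x = ?z \<Longrightarrow> x = ?z" if "x \<in> ?P" for x
    using fix_iff[OF closed[OF that]] invol[OF that] by (auto simp: involution_def)
  have "even (card (?P - {?z}))"
    by (rule even_card_fixpoint_free_involution[where f = ?f])
      (use fin closed invol free fz in auto)
  moreover have "(\<exists>x\<in>?P. involution (Zt22 t) x) \<longleftrightarrow> ?z \<in> ?P"
    using fix_iff by blast
  moreover have "card ?P = of_bool (?z \<in> ?P) + card (?P - {?z})"
    using card.remove[OF fin, of ?z] by (cases "?z \<in> ?P") simp_all
  ultimately show ?thesis by (metis even_add odd_of_bool_self)
qed

section \<open>Character sums over the two factors\<close>

text \<open>The parts are the fibres of \<open>snd\<close>, on which the summand is constant. With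
  \<open>f\<close> constantly 1 this yields the cardinality of \<open>X\<close>, with
  \<open>f\<close> a character the signed sum of its part sizes.\<close>

lemma sum_over_parts:
  fixes f :: "int \<times> int \<Rightarrow> int"
  assumes "t > 0" "X \<subseteq> carrier (Zt22 t)"
  shows "(\<Sum>x\<in>X. f (snd x)) =
    int (card (part t X 0 0)) * f (0, 0) + int (card (part t X 0 1)) * f (0, 1) +
    int (card (part t X 1 0)) * f (1, 0) + int (card (part t X 1 1)) * f (1, 1)"
proof -
  have fin: "finite X"
    using assms(2) by (rule finite_subset) (simp add: carrier_Zt22 assms(1))
  have fib: "{x \<in> X. snd x = (i, j)} = part t X i j" for i j
    using assms by (auto simp: part_def carrier_Zt22 carrier_integer_mod_group)
  have "(\<Sum>x\<in>X. f (snd x)) = (\<Sum>y\<in>{0,1} \<times> {0,1}. \<Sum>x\<in>{x \<in> X. snd x = y}. f (snd x))"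
    using assms by (intro sum.group[symmetric] fin) (auto simp: carrier_Zt22)
  also have "\<dots> = (\<Sum>y\<in>{0,1} \<times> {0,1}. int (card {x \<in> X. snd x = y}) * f y)"
    by (intro sum.cong) auto
  also have "{0,1} \<times> {0,1} = {(0,0), (0,1), (1,0), (1,1)::int \<times> int}" by auto
  finally show ?thesis by (simp add: fib)
qed

lemma card_part_carrier:
  assumes "t > 0" "i \<in> {0,1}" "j \<in> {0,1}"
  shows "card (part t (carrier (Zt22 t)) i j) = t"
proof -
  have "part t (carrier (Zt22 t)) i j = {0..<int t} \<times> {i} \<times> {j}"
    using assms by (auto simp: part_def carrier_Zt22 carrier_integer_mod_group)
  then show ?thesis by (simp add: card_cartesian_product)
qed

text \<open>Surjectivity is the sum set condition; injectivity follows by counting, since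
  \<open>r * s = order G - 1\<close> makes both finite sets equally large.\<close>

lemma near_factorization_bij_betw:
  assumes "near_factorization G r s A B" "finite (carrier G)"
    "\<one>\<^bsub>G\<^esub> \<in> carrier G"
  shows "bij_betw (\<lambda>(a, b). a \<otimes>\<^bsub>G\<^esub> b) (A \<times> B) (carrier G - {\<one>\<^bsub>G\<^esub>})"
proof -
  have img: "(\<lambda>(a, b). a \<otimes>\<^bsub>G\<^esub> b) ` (A \<times> B) = carrier G - {\<one>\<^bsub>G\<^esub>}"
  proof -
    have "(\<lambda>(a, b). a \<otimes>\<^bsub>G\<^esub> b) ` (A \<times> B) = A <#>\<^bsub>G\<^esub> B"
      by (force simp: set_mult_def)
    then show ?thesis
      using assms(1) by (simp only: near_factorization_def)
  qed
  have "finite (A \<times> B)"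
    using assms by (auto simp: near_factorization_def intro: finite_subset)
  moreover have "card (A \<times> B) = card (carrier G - {\<one>\<^bsub>G\<^esub>})"
    using assms by (simp add: near_factorization_def card_cartesian_product order_def)
  ultimately show ?thesis
    using img by (auto simp: bij_betw_def intro: eq_card_imp_inj_on)
qed

text \<open>Expanding the product and reindexing along the bijection gives the sum of
  \<open>\<chi>\<close> over the group without its identity. For a nontrivial character the bracket
  vanishes and \<open>\<chi> (0, 0) = 1\<close>, so the right side is -1. Integer values suffice
  because the characters of the Klein four-group are real with values 1 and -1.\<close>

lemma character_product:
  fixes \<chi> :: "int \<times> int \<Rightarrow> int"
  assumes "t > 0" "near_factorization (Zt22 t) r s A B"
    "\<And>i j k l. i \<in> {0,1} \<Longrightarrow> j \<in> {0,1} \<Longrightarrow> k \<in> {0,1} \<Longrightarrow> l \<in> {0,1} \<Longrightarrow>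
      \<chi> ((i + k) mod 2, (j + l) mod 2) = \<chi> (i, j) * \<chi> (k, l)"
  shows "(\<Sum>x\<in>A. \<chi> (snd x)) * (\<Sum>y\<in>B. \<chi> (snd y)) =
    int t * (\<chi> (0, 0) + \<chi> (0, 1) + \<chi> (1, 0) + \<chi> (1, 1)) - \<chi> (0, 0)"
proof -
  let ?G = "Zt22 t"
  have fin: "finite (carrier ?G)" by (simp add: carrier_Zt22 assms(1))
  have one: "\<one>\<^bsub>?G\<^esub> = (0, 0, 0)" by (simp add: Zt22_def)
  have one': "\<one>\<^bsub>?G\<^esub> \<in> carrier ?G" by (simp add: one carrier_Zt22 assms(1))
  have hom: "\<chi> (snd (x \<otimes>\<^bsub>?G\<^esub> y)) = \<chi> (snd x) * \<chi> (snd y)" if "x \<in> A" "y \<in> B" for x y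
  proof -
    obtain m i j n k l where xy: "x = (m, i, j)" "y = (n, k, l)"
      by (metis prod.exhaust)
    have "x \<in> carrier ?G" "y \<in> carrier ?G"
      using that assms(2) by (auto simp: near_factorization_def)
    then have "i \<in> {0,1}" "j \<in> {0,1}" "k \<in> {0,1}" "l \<in> {0,1}"
      by (auto simp: xy carrier_Zt22 assms(1))
    then show ?thesis
      unfolding xy mult_Zt22 snd_conv by (rule assms(3))
  qed
  have "(\<Sum>x\<in>A. \<chi> (snd x)) * (\<Sum>y\<in>B. \<chi> (snd y)) =
      (\<Sum>p\<in>A \<times> B. \<chi> (snd (case p of (x, y) \<Rightarrow> x \<otimes>\<^bsub>?G\<^esub> y)))"
    by (auto simp: sum_product sum.cartesian_product hom intro!: sum.cong)
  also have "\<dots> = (\<Sum>z\<in>carrier ?G - {\<one>\<^bsub>?G\<^esub>}. \<chi> (snd z))"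
    by (rule sum.reindex_bij_betw[OF near_factorization_bij_betw[OF assms(2) fin one']])
  also have "\<dots> = (\<Sum>z\<in>carrier ?G. \<chi> (snd z)) - \<chi> (snd \<one>\<^bsub>?G\<^esub>)"
    using fin one' by (simp add: sum_diff1)
  also have "(\<Sum>z\<in>carrier ?G. \<chi> (snd z)) =
      int t * (\<chi> (0, 0) + \<chi> (0, 1) + \<chi> (1, 0) + \<chi> (1, 1))"
    by (simp add: sum_over_parts[OF assms(1) subset_refl] card_part_carrier assms(1) algebra_simps)
  finally show ?thesis by (simp add: one)
qed

section \<open>Recovering the part sizes from the character values\<close>

lemma part_sizes_from_characters:
  fixes a b :: "int \<Rightarrow> int \<Rightarrow> int" and u v :: int
  assumes "a 0 0 + a 0 1 + a 1 0 + a 1 1 = 4 * u + 1"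
    and "b 0 0 + b 0 1 + b 1 0 + b 1 1 = 4 * v - 1"
    and "(a 0 0 - a 0 1 + a 1 0 - a 1 1) * (b 0 0 - b 0 1 + b 1 0 - b 1 1) = -1"
    and "(a 0 0 + a 0 1 - a 1 0 - a 1 1) * (b 0 0 + b 0 1 - b 1 0 - b 1 1) = -1"
    and "(a 0 0 - a 0 1 - a 1 0 + a 1 1) * (b 0 0 - b 0 1 - b 1 0 + b 1 1) = -1"
  obtains i0 j0 where "i0 \<in> {0,1}" "j0 \<in> {0,1}"
    "\<And>i j. i \<in> {0,1} \<Longrightarrow> j \<in> {0,1} \<Longrightarrow>
      a i j = u + of_bool ((i, j) = (i0, j0)) \<and> b i j = v - of_bool ((i, j) = (i0, j0))"
proof -
  \<comment> \<open>The only units of the integers are 1 and -1.\<close>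
  have unit: "y = - x \<and> (x = 1 \<or> x = -1)" if "x * y = -1" for x y :: int
  proof -
    have "x * (- y) = 1" using that by simp
    then show ?thesis using zmult_eq_1_iff[of x "- y"] by auto
  qed
  define p q w where "p = a 0 0 - a 0 1 + a 1 0 - a 1 1"
    and "q = a 0 0 + a 0 1 - a 1 0 - a 1 1"
    and "w = a 0 0 - a 0 1 - a 1 0 + a 1 1"
  have neg: "b 0 0 - b 0 1 + b 1 0 - b 1 1 = - p"
      "b 0 0 + b 0 1 - b 1 0 - b 1 1 = - q"
      "b 0 0 - b 0 1 - b 1 0 + b 1 1 = - w"
    and sgn: "p = 1 \<or> p = -1" "q = 1 \<or> q = -1" "w = 1 \<or> w = -1"
    using assms(3-5) unit unfolding p_def q_def w_def by blast+
  \<comment> \<open>Fourier inversion: the 4 by 4 character table is a symmetric Hadamard matrix,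
    whose square is 4 times the identity.\<close>
  have inv: "4 * a 0 0 = 4 * u + 1 + p + q + w" "4 * a 0 1 = 4 * u + 1 - p + q - w"
    "4 * a 1 0 = 4 * u + 1 + p - q - w" "4 * a 1 1 = 4 * u + 1 - p - q + w"
    "4 * b 0 0 = 4 * v - 1 - p - q - w" "4 * b 0 1 = 4 * v - 1 + p - q + w"
    "4 * b 1 0 = 4 * v - 1 - p + q + w" "4 * b 1 1 = 4 * v - 1 + p + q - w"
    using assms(1,2) neg unfolding p_def q_def w_def by linarith+
  \<comment> \<open>With signs \<open>p\<close>, \<open>q\<close>, \<open>w\<close> this sum is 4,
    2, 0 or -2 according to the number of minus signs, so that number is 0 or 2. In each surviving
    case \<open>(p, q, w)\<close> lists the values of the three nontrivial characters at the
    exceptional index \<open>(i0, j0)\<close>.\<close>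
  have "4 dvd 1 + p + q + w"
    using inv(1) by presburger
  then consider "p = 1" "q = 1" "w = 1" | "p = -1" "q = 1" "w = -1"
    | "p = 1" "q = -1" "w = -1" | "p = -1" "q = -1" "w = 1"
    using sgn by auto
  then show ?thesis
  proof cases
    case 1
    then have "a 0 0 = u + 1" "a 0 1 = u" "a 1 0 = u" "a 1 1 = u"
      "b 0 0 = v - 1" "b 0 1 = v" "b 1 0 = v" "b 1 1 = v"
      using inv by linarith+
    then show ?thesis by (intro that[of 0 0]) auto
  next
    case 2
    then have "a 0 0 = u" "a 0 1 = u + 1" "a 1 0 = u" "a 1 1 = u"
      "b 0 0 = v" "b 0 1 = v - 1" "b 1 0 = v" "b 1 1 = v"
      using inv by linarith+
    then show ?thesis by (intro that[of 0 1]) auto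
  next
    case 3
    then have "a 0 0 = u" "a 0 1 = u" "a 1 0 = u + 1" "a 1 1 = u"
      "b 0 0 = v" "b 0 1 = v" "b 1 0 = v - 1" "b 1 1 = v"
      using inv by linarith+
    then show ?thesis by (intro that[of 1 0]) auto
  next
    case 4
    then have "a 0 0 = u" "a 0 1 = u" "a 1 0 = u" "a 1 1 = u + 1"
      "b 0 0 = v" "b 0 1 = v" "b 1 0 = v" "b 1 1 = v - 1"
      using inv by linarith+
    then show ?thesis by (intro that[of 1 1]) auto
  qed
qed

section \<open>Sizes, parities and involutions of the parts of a near-factorization\<close>

theorem mainTheorem4:
  fixes t r s :: nat
    and A B :: "(int \<times> int \<times> int) set"
  assumes "odd t" and "t > 0"
    and "near_factorization (Zt22 t) r s A B"
    and "symmetric_subset (Zt22 t) A"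
    and "symmetric_subset (Zt22 t) B"
    and "r mod 4 = 1" and "s mod 4 = 3"
  shows
    "(\<exists>i0\<in>{0,1}. \<exists>j0\<in>{0,1}.
        real (card (part t A i0 j0)) = (real r + 3) / 4 \<and>
        real (card (part t B i0 j0)) = (real s - 3) / 4 \<and>
        (\<forall>i\<in>{0,1}. \<forall>j\<in>{0,1}. (i, j) \<noteq> (i0, j0) \<longrightarrow>
           real (card (part t A i j)) = (real r - 1) / 4 \<and>
           real (card (part t B i j)) = (real s + 1) / 4))
     \<and> (\<forall>i\<in>{0,1}. \<forall>j\<in>{0,1}.
           even (card (part t A i j)) \<noteq> even (card (part t B i j)))
     \<and> (\<forall>i\<in>{0,1}. \<forall>j\<in>{0,1}.
           (odd (card (part t A i j)) \<longleftrightarrow> (\<exists>x\<in>part t A i j. involution (Zt22 t) x)) \<and>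
           (odd (card (part t B i j)) \<longleftrightarrow> (\<exists>x\<in>part t B i j. involution (Zt22 t) x)))"
proof -
  note nf = assms(3)
  have AG: "A \<subseteq> carrier (Zt22 t)" and BG: "B \<subseteq> carrier (Zt22 t)"
    and cA: "card A = r" and cB: "card B = s" and rs: "r * s = order (Zt22 t) - 1"
    using nf by (auto simp: near_factorization_def)
  \<comment> \<open>These are \<open>(r - 1) / 4\<close> and \<open>(s + 1) / 4\<close>, the sizes
    of the non-exceptional parts; the added 1 rounds up because \<open>s\<close> leaves remainder
    3.\<close>
  define u v where "u = int (r div 4)" and "v = int (s div 4) + 1"
  have r: "int r = 4 * u + 1" and s: "int s = 4 * v - 1"
    using assms(6,7) unfolding u_def v_def by presburger+
  let ?a = "\<lambda>i j. int (card (part t A i j))" and ?b = "\<lambda>i j. int (card (part t B i j))"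
  note sumA = sum_over_parts[OF assms(2) AG] and sumB = sum_over_parts[OF assms(2) BG]
  note char = character_product[OF assms(2) nf, unfolded sumA sumB]
  have "?a 0 0 + ?a 0 1 + ?a 1 0 + ?a 1 1 = 4 * u + 1"
    using sumA[of "\<lambda>_. 1"] cA r by simp
  moreover have "?b 0 0 + ?b 0 1 + ?b 1 0 + ?b 1 1 = 4 * v - 1"
    using sumB[of "\<lambda>_. 1"] cB s by simp
  \<comment> \<open>The three nontrivial characters follow in turn: the sign given by
    \<open>j\<close>, by \<open>i\<close>, and by \<open>i + j\<close>.\<close>
  moreover have "(?a 0 0 - ?a 0 1 + ?a 1 0 - ?a 1 1) * (?b 0 0 - ?b 0 1 + ?b 1 0 - ?b 1 1) = -1"
    using char[of "\<lambda>(i, j). if j = 0 then 1 else -1"] by fastforce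
  moreover have "(?a 0 0 + ?a 0 1 - ?a 1 0 - ?a 1 1) * (?b 0 0 + ?b 0 1 - ?b 1 0 - ?b 1 1) = -1"
    using char[of "\<lambda>(i, j). if i = 0 then 1 else -1"] by fastforce
  moreover have "(?a 0 0 - ?a 0 1 - ?a 1 0 + ?a 1 1) * (?b 0 0 - ?b 0 1 - ?b 1 0 + ?b 1 1) = -1"
    using char[of "\<lambda>(i, j). if i = j then 1 else -1"] by fastforce
  ultimately obtain i0 j0 :: int where ij0: "i0 \<in> {0,1}" "j0 \<in> {0,1}"
    and size: "\<And>i j. i \<in> {0,1} \<Longrightarrow> j \<in> {0,1} \<Longrightarrow>
      ?a i j = u + of_bool ((i, j) = (i0, j0)) \<and> ?b i j = v - of_bool ((i, j) = (i0, j0))"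
    by (rule part_sizes_from_characters[where a = ?a and b = ?b]) blast
  have "order (Zt22 t) = 4 * t"
    by (simp add: order_def carrier_Zt22 assms(2) card_cartesian_product)
  then have "int r * int s = 4 * int t - 1"
    using rs assms(2) by (simp flip: of_nat_mult)
  then have "int t = 4 * (u * v) - u + v"
    unfolding r s by (simp add: algebra_simps)
  then have parity: "even u \<noteq> even v"
    using assms(1) by presburger
  have real_rs: "real r = 4 * of_int u + 1" "real s = 4 * of_int v - 1"
    using r s by linarith+
  have real_size: "real (card (part t A i j)) = of_int u + of_bool ((i, j) = (i0, j0)) \<and>
      real (card (part t B i j)) = of_int v - of_bool ((i, j) = (i0, j0))"
    if "i \<in> {0,1}" "j \<in> {0,1}" for i j
    using size[OF that] by (metis of_int_add of_int_diff of_int_of_bool of_int_of_nat_eq)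
  have part1: "\<exists>i0\<in>{0,1}. \<exists>j0\<in>{0,1}.
        real (card (part t A i0 j0)) = (real r + 3) / 4 \<and>
        real (card (part t B i0 j0)) = (real s - 3) / 4 \<and>
        (\<forall>i\<in>{0,1}. \<forall>j\<in>{0,1}. (i, j) \<noteq> (i0, j0) \<longrightarrow>
           real (card (part t A i j)) = (real r - 1) / 4 \<and>
           real (card (part t B i j)) = (real s + 1) / 4)"
  proof (rule bexI[OF _ ij0(1)], rule bexI[OF _ ij0(2)], intro conjI ballI impI)
    show "real (card (part t A i0 j0)) = (real r + 3) / 4"
      "real (card (part t B i0 j0)) = (real s - 3) / 4"
      using real_size[OF ij0] real_rs by simp_all
  next
    fix i j :: int
    assume "i \<in> {0,1}" "j \<in> {0,1}" "(i, j) \<noteq> (i0, j0)"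
    then show "real (card (part t A i j)) = (real r - 1) / 4"
      "real (card (part t B i j)) = (real s + 1) / 4"
      using real_size[of i j] real_rs by simp_all
  qed
  have part2: "\<forall>i\<in>{0,1}. \<forall>j\<in>{0,1}. even (card (part t A i j)) \<noteq> even (card (part t B i j))"
  proof (intro ballI)
    fix i j :: int
    assume "i \<in> {0,1}" "j \<in> {0,1}"
    \<comment> \<open>The sizes are \<open>u\<close> and \<open>v\<close>, or \<open>u + 1\<close>
      and \<open>v - 1\<close> at the exceptional index; there both parities flip, so they still
      differ.\<close>
    then have "even (?a i j) \<noteq> even (?b i j)"
      using size[of i j] parity by (cases "(i, j) = (i0, j0)") auto
    then show "even (card (part t A i j)) \<noteq> even (card (part t B i j))" by simp
  qed
  show ?thesis
    by (intro conjI ballI part1 part2[rule_format] odd_card_part_iff assms)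
qed

end
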